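(* The cluster algebra $A$ over $\mathbb Z$ associated to the Markov quiver, i.e. to the seed $((x_1,x_2,x_3),B)$ without frozen variables and with $$B=\begin{pmatrix}0&2&-2\\-2&0&2\\2&-2&0\end{pmatrix},$$ is not a Krull domain.
   Context: The Markov quiver has vertices $1,2,3$, two arrows $1\to2$, two arrows $2\to3$ and two arrows $3\to1$; all vertices are exchangeable, and $b_{ij}$ is the number of arrows $i\to j$ minus the number of arrows $j\to i$. Let $\mathcal F=\mathbb Q(x_1,x_2,x_3)$ with $x_1,x_2,x_3$ algebraically independent. Starting from a seed $((x_1,x_2,x_3),B)$, the exchange polynomials are $f_i=\prod_{j:\,b_{ji}>0}x_j^{b_{ji}}+\prod_{j:\,b_{ji}<0}x_j^{-b_{ji}}$, and mutation in direction $i$ replaces $x_i$ by $x_i'=f_i/x_i\in\mathcal F$ and $B$ by $B'=(b'_{kl})$, where $b'_{kl}=-b_{kl}$ if $k=i$ or $l=i$, and $b'_{kl}=b_{kl}+\tfrac12(|b_{ki}|b_{il}+b_{ki}|b_{il}|)$ otherwise. The cluster algebra $A$ is the $\mathbb Z$-subalgebra of $\mathcal F$ generated by all variables occurring in seeds obtained from the initial one by finite sequences of mutations. *)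

theory Defs
  imports
    "HOL-Analysis.Cartesian_Space"
    "HOL-Computational_Algebra.Fraction_Field"
    "HOL-Library.Extended_Nat"
    "HOL-Algebra.Algebraic_Closure_Type"
    "HOL-Algebra.Generated_Rings"
begin

section \<open>Krull domains\<close>

text \<open>The height of a prime ideal: the supremum of the lengths \<open>n\<close> of chains
  \<open>c 0 \<subset> c 1 \<subset> \<dots> \<subset> c n = P\<close> of prime ideals.\<close>

definition prime_height :: "('a, 'b) ring_scheme \<Rightarrow> 'a set \<Rightarrow> enat" where
  "prime_height R P =
     Sup {enat n | n. \<exists>c. c n = P \<and> (\<forall>i\<le>n. primeideal (c i) R) \<and> (\<forall>i<n. c i \<subset> c (Suc i))}"

definition height_one_primes :: "('a, 'b) ring_scheme \<Rightarrow> 'a set set" where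
  "height_one_primes R = {P. primeideal P R \<and> prime_height R P = 1}"

definition discrete_valuation_ring :: "('a, 'b) ring_scheme \<Rightarrow> bool" where
  "discrete_valuation_ring R \<longleftrightarrow>
     principal_domain R \<and> \<not> field R \<and> (\<exists>!M. maximalideal M R)"

text \<open>Domains are given as subrings \<open>A\<close> of a field \<open>K\<close>, possibly larger than the quotient
  field of \<open>A\<close>. Localizations of \<open>A\<close> are then taken inside \<open>K\<close>; the localization at the zero
  ideal is the quotient field of \<open>A\<close>.\<close>

definition localization_at :: "('a, 'b) ring_scheme \<Rightarrow> 'a set \<Rightarrow> 'a set \<Rightarrow> 'a set" where
  "localization_at K A P = {a \<otimes>\<^bsub>K\<^esub> inv\<^bsub>K\<^esub> s | a s. a \<in> A \<and> s \<in> A - P}"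

definition quotient_field :: "('a, 'b) ring_scheme \<Rightarrow> 'a set \<Rightarrow> 'a set" where
  "quotient_field K A = localization_at K A {\<zero>\<^bsub>K\<^esub>}"

definition krull_domain :: "('a, 'b) ring_scheme \<Rightarrow> 'a set \<Rightarrow> bool" where
  "krull_domain K A \<longleftrightarrow>
     field K \<and> subdomain A K \<and>
     (let H = height_one_primes (K\<lparr>carrier := A\<rparr>) in
        (\<forall>P\<in>H. discrete_valuation_ring (K\<lparr>carrier := localization_at K A P\<rparr>)) \<and>
        A = {x \<in> quotient_field K A. \<forall>P\<in>H. x \<in> localization_at K A P} \<and>
        (\<forall>a\<in>A - {\<zero>\<^bsub>K\<^esub>}. finite {P \<in> H. a \<in> P}))"


section \<open>Cluster algebras without frozen variables\<close>

text \<open>Throughout, \<open>B $ i $ j\<close> is the entry in row \<open>i\<close> and column \<open>j\<close>.\<close>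

definition exchange_polynomial :: "'f::field ^ 'n \<Rightarrow> int ^ 'n ^ 'n \<Rightarrow> 'n::finite \<Rightarrow> 'f" where
  "exchange_polynomial x B i =
     (\<Prod>j | B $ j $ i > 0. (x $ j) ^ nat (B $ j $ i)) +
     (\<Prod>j | B $ j $ i < 0. (x $ j) ^ nat (- (B $ j $ i)))"

definition mutate_cluster :: "'f::field ^ 'n \<Rightarrow> int ^ 'n ^ 'n \<Rightarrow> 'n::finite \<Rightarrow> 'f ^ 'n" where
  "mutate_cluster x B i = (\<chi> j. if j = i then exchange_polynomial x B i / x $ i else x $ j)"

text \<open>The integer division by 2 is exact, since \<open>\<bar>a\<bar> * b + a * \<bar>b\<bar>\<close> is \<open>0\<close> or \<open>\<plusminus>2 * a * b\<close>.\<close>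

definition mutate_matrix :: "int ^ 'n ^ 'n \<Rightarrow> 'n::finite \<Rightarrow> int ^ 'n ^ 'n" where
  "mutate_matrix B i =
     (\<chi> k l. if k = i \<or> l = i then - (B $ k $ l)
             else B $ k $ l + (\<bar>B $ k $ i\<bar> * B $ i $ l + B $ k $ i * \<bar>B $ i $ l\<bar>) div 2)"

inductive mutation_reachable ::
  "'f::field ^ 'n \<Rightarrow> int ^ 'n ^ 'n \<Rightarrow> 'f ^ 'n \<Rightarrow> int ^ 'n ^ 'n::finite \<Rightarrow> bool"
  for x :: "'f ^ 'n" and B :: "int ^ 'n ^ 'n" where
  initial: "mutation_reachable x B x B"
| mutate: "mutation_reachable x B y C \<Longrightarrow>
           mutation_reachable x B (mutate_cluster y C i) (mutate_matrix C i)"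

definition cluster_variables :: "'f::field ^ 'n \<Rightarrow> int ^ 'n ^ 'n::finite \<Rightarrow> 'f set" where
  "cluster_variables x B = {y $ i | y C i. mutation_reachable x B y C}"

definition cluster_algebra :: "'f::field ^ 'n \<Rightarrow> int ^ 'n ^ 'n::finite \<Rightarrow> 'f set" where
  "cluster_algebra x B = generate_ring ring_of_type_algebra (cluster_variables x B)"


section \<open>The Markov seed\<close>

text \<open>\<open>\<rat>(x\<^sub>1, x\<^sub>2, x\<^sub>3)\<close> as the fraction field of \<open>\<rat>[x\<^sub>1][x\<^sub>2][x\<^sub>3]\<close>.\<close>

type_synonym ratfun3 = "rat poly poly poly fract"

definition markov_cluster :: "ratfun3 ^ 3" where
  "markov_cluster = vector [Fract [:[:[:0, 1:]:]:] 1, Fract [:[:0, 1:]:] 1, Fract [:0, 1:] 1]"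

definition markov_matrix :: "int ^ 3 ^ 3" where
  "markov_matrix = vector [vector [ 0,  2, -2],
                           vector [-2,  0,  2],
                           vector [ 2, -2,  0]]"

text \<open>The first two conditions in \<^const>\<open>krull_domain\<close> always hold for a cluster algebra.\<close>

lemma cluster_algebra_subdomain:
  fixes x :: "'f::field ^ 'n::finite" and B :: "int ^ 'n ^ 'n"
  shows "field (ring_of_type_algebra :: 'f ring)"
    and "subdomain (cluster_algebra x B) ring_of_type_algebra"
proof -
  let ?K = "ring_of_type_algebra :: 'f ring"
  show K: "field ?K" by (rule field_from_type_algebra)
  interpret field ?K by (rule K)
  have "carrier ?K = UNIV" by (simp add: ring_of_type_algebra_def)
  then have "subring (cluster_algebra x B) ?K"
    unfolding cluster_algebra_def by (intro generate_ring_is_subring) simp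
  then show "subdomain (cluster_algebra x B) ?K"
    by (intro subdomainI subcringI') (auto simp: ring_of_type_algebra_def)
qed

end

theory Submission
  imports Defs
begin

text \<open>The element \<open>M = (x\<^sub>1\<^sup>2 + x\<^sub>2\<^sup>2 + x\<^sub>3\<^sup>2) / (x\<^sub>1 x\<^sub>2 x\<^sub>3)\<close> is the same for every cluster, because
  \<open>x\<^sub>i + x\<^sub>i' = M x\<^sub>j x\<^sub>k\<close>. Specializing \<open>x\<^sub>1 = x\<^sub>2 = x\<^sub>3 = t\<close> maps every cluster variable to a nonzero
  multiple of \<open>t\<close>, hence \<open>A\<close> into \<open>\<rat>[t]\<close>, but it maps \<open>M\<close> to \<open>3 / t\<close>; so \<open>M \<notin> A\<close>. If \<open>A\<close> were
  Krull, then \<open>M \<notin> A\<^sub>P\<close> for some prime \<open>P\<close> of height one. Since \<open>M = (x\<^sub>i + x\<^sub>i') / (x\<^sub>j x\<^sub>k)\<close> and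
  \<open>x\<^sub>i x\<^sub>i' = x\<^sub>j\<^sup>2 + x\<^sub>k\<^sup>2\<close>, such a \<open>P\<close> contains all cluster variables. It therefore contains the
  kernel of the specialization, because an element of \<open>A\<close> is congruent modulo \<open>P\<close> to its
  constant term. But this kernel is a prime strictly between \<open>0\<close> and \<open>P\<close>, so that \<open>P\<close> has
  height at least two.\<close>

no_notation fps_nth (infixl "$" 75)

section \<open>Prime ideals in subrings of a field\<close>

lemma ring_of_type_algebra_simps [simp]:
  "carrier ring_of_type_algebra = UNIV"
  "x \<otimes>\<^bsub>ring_of_type_algebra\<^esub> y = x * y"
  "\<one>\<^bsub>ring_of_type_algebra\<^esub> = 1"
  "\<zero>\<^bsub>ring_of_type_algebra\<^esub> = 0"
  "x \<oplus>\<^bsub>ring_of_type_algebra\<^esub> y = x + y"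
  by (simp_all add: ring_of_type_algebra_def)

lemma a_inv_ring_of_type_algebra [simp]:
  "\<ominus>\<^bsub>ring_of_type_algebra\<^esub> x = - (x :: 'a::comm_ring_1)"
proof -
  interpret cring "ring_of_type_algebra :: 'a ring" by (rule cring_from_type_algebra)
  show ?thesis by (rule minus_equality) simp_all
qed

lemma m_inv_ring_of_type_algebra:
  fixes x :: "'a::field"
  assumes "x \<noteq> 0"
  shows "inv\<^bsub>ring_of_type_algebra\<^esub> x = inverse x"
proof -
  interpret cring "ring_of_type_algebra :: 'a ring" by (rule cring_from_type_algebra)
  show ?thesis using assms by (intro comm_inv_char) simp_all
qed

lemma divide_in_localization_at:
  fixes a s :: "'a::field"
  assumes "a \<in> A" "s \<in> A" "s \<notin> P" "s \<noteq> 0"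
  shows "a / s \<in> localization_at ring_of_type_algebra A P"
  unfolding localization_at_def using assms
  by (intro CollectI exI[of _ a] exI[of _ s]) (simp add: m_inv_ring_of_type_algebra divide_inverse)

text \<open>Reduces primality to conditions in plain field arithmetic. Closure under additive
  inverses does not appear on the right because it follows from closure under multiplication by
  \<open>- 1\<close>, an element of \<open>A\<close>.\<close>

lemma primeideal_type_algebra_iff:
  fixes A :: "'a::field set"
  assumes "subdomain A ring_of_type_algebra"
  shows "primeideal P (ring_of_type_algebra\<lparr>carrier := A\<rparr>) \<longleftrightarrow>
    P \<subseteq> A \<and> P \<noteq> A \<and> 0 \<in> P \<and> (\<forall>x\<in>P. \<forall>y\<in>P. x + y \<in> P) \<and> (\<forall>a\<in>A. \<forall>x\<in>P. a * x \<in> P) \<and>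
    (\<forall>a\<in>A. \<forall>b\<in>A. a * b \<in> P \<longrightarrow> a \<in> P \<or> b \<in> P)" (is "?L \<longleftrightarrow> ?R")
proof -
  interpret K: field "ring_of_type_algebra :: 'a ring" by (rule field_from_type_algebra)
  let ?A = "ring_of_type_algebra\<lparr>carrier := A\<rparr>"
  interpret A: "domain" ?A by (rule K.subdomain_is_domain[OF assms])
  have minus_one: "- 1 \<in> A"
    using subdomainE(3,5)[OF assms] by force
  show ?thesis
  proof
    assume ?L
    then interpret primeideal P ?A .
    show ?R
      using a_subset I_notcarr additive_subgroup.zero_closed[OF additive_subgroup_axioms]
        a_closed I_l_closed I_prime by auto
  next
    assume R: ?R
    have neg: "\<ominus>\<^bsub>?A\<^esub> x \<in> P" if "x \<in> P" for x
    proof -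
      have "- x \<in> P" using R minus_one that by (metis mult_minus1)
      moreover have "\<ominus>\<^bsub>?A\<^esub> x = - x"
        using R that calculation by (intro A.minus_equality) auto
      ultimately show ?thesis by simp
    qed
    have sub: "subgroup P (add_monoid ?A)"
    proof (intro subgroup.intro)
      show "P \<subseteq> carrier (add_monoid ?A)" "\<one>\<^bsub>add_monoid ?A\<^esub> \<in> P" using R by simp_all
      show "x \<otimes>\<^bsub>add_monoid ?A\<^esub> y \<in> P" if "x \<in> P" "y \<in> P" for x y
        using R that by simp
      show "inv\<^bsub>add_monoid ?A\<^esub> x \<in> P" if "x \<in> P" for x
        using neg[OF that] by (simp only: a_inv_def)
    qed
    show ?L
    proof (intro primeidealI2 additive_subgroupI A.is_cring sub)
      show "x \<otimes>\<^bsub>?A\<^esub> a \<in> P" "a \<otimes>\<^bsub>?A\<^esub> x \<in> P" if "a \<in> P" "x \<in> carrier ?A" for a x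
        using R that by (simp_all add: mult.commute[of a])
      show "carrier ?A \<noteq> P" using R by auto
      show "a \<in> P \<or> b \<in> P" if "a \<in> carrier ?A" "b \<in> carrier ?A" "a \<otimes>\<^bsub>?A\<^esub> b \<in> P" for a b
        using R that by simp
    qed
  qed
qed

lemma primeideal_type_algebraD:
  fixes A :: "'a::field set"
  assumes "subdomain A ring_of_type_algebra" "primeideal P (ring_of_type_algebra\<lparr>carrier := A\<rparr>)"
  shows "x \<in> P \<Longrightarrow> x \<in> A" "0 \<in> P" "x \<in> P \<Longrightarrow> y \<in> P \<Longrightarrow> x + y \<in> P"
    "a \<in> A \<Longrightarrow> x \<in> P \<Longrightarrow> a * x \<in> P"
    "a \<in> A \<Longrightarrow> b \<in> A \<Longrightarrow> a * b \<in> P \<Longrightarrow> a \<in> P \<or> b \<in> P"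
  using assms(2) unfolding primeideal_type_algebra_iff[OF assms(1)] by blast+

text \<open>A chain of three primes ending in \<open>P\<^sub>2\<close> has length 2, so the supremum
  is at least 2.\<close>

lemma prime_height_neq_one:
  assumes "primeideal P\<^sub>0 R" "primeideal P\<^sub>1 R" "primeideal P\<^sub>2 R" "P\<^sub>0 \<subset> P\<^sub>1" "P\<^sub>1 \<subset> P\<^sub>2"
  shows "prime_height R P\<^sub>2 \<noteq> 1"
proof -
  define c where "c = (\<lambda>i::nat. if i = 0 then P\<^sub>0 else if i = 1 then P\<^sub>1 else P\<^sub>2)"
  have "c 2 = P\<^sub>2" "\<forall>i\<le>2. primeideal (c i) R" "\<forall>i<2. c i \<subset> c (Suc i)"
    using assms by (simp_all add: c_def less_2_cases_iff)
  then have "enat 2 \<le> prime_height R P\<^sub>2"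
    unfolding prime_height_def by (intro Sup_upper) blast
  then show ?thesis by (auto simp: one_enat_def)
qed

section \<open>Specialization to the diagonal\<close>

text \<open>The polynomial \<open>p(t, t, t)\<close>: the outermost variable \<open>x\<^sub>3\<close> is replaced by \<open>x\<^sub>2\<close>, then
  \<open>x\<^sub>2\<close> by \<open>x\<^sub>1\<close>.\<close>

definition diagonal :: "'a::idom poly poly poly \<Rightarrow> 'a poly" where
  "diagonal p = poly (poly p [:0, 1:]) [:0, 1:]"

lemma diagonal_simps [simp]:
  "diagonal 0 = 0"
  "diagonal 1 = 1"
  "diagonal (p + q) = diagonal p + diagonal q"
  "diagonal (- p) = - diagonal p"
  "diagonal (p * q) = diagonal p * diagonal q"
  by (simp_all add: diagonal_def)

text \<open>A relation rather than a function, since a rational function need not be defined on the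
  diagonal.\<close>

definition restricts_to :: "'a::idom poly poly poly fract \<Rightarrow> 'a poly \<Rightarrow> bool" where
  "restricts_to f g \<longleftrightarrow>
     (\<exists>p q. diagonal q \<noteq> 0 \<and> f = Fract p q \<and> diagonal p = g * diagonal q)"

text \<open>Cross-multiply the two fractions, specialize the resulting polynomial identity, and
  cancel the denominators, which do not vanish on the diagonal. So the relation is a partial
  function.\<close>

lemma restricts_to_unique:
  assumes "restricts_to f g" "restricts_to f h"
  shows "g = h"
proof -
  obtain p q p' q' where *: "diagonal q \<noteq> 0" "f = Fract p q" "diagonal p = g * diagonal q"
     "diagonal q' \<noteq> 0" "f = Fract p' q'" "diagonal p' = h * diagonal q'"
    using assms unfolding restricts_to_def by blast
  then have "q \<noteq> 0" "q' \<noteq> 0" by auto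
  with * have "p * q' = p' * q" by (simp add: eq_fract)
  then have "diagonal p * diagonal q' = diagonal p' * diagonal q" by (metis diagonal_simps(5))
  with * show ?thesis by (simp add: algebra_simps)
qed

lemma restricts_to_Fract: "restricts_to (Fract p 1) (diagonal p)"
  unfolding restricts_to_def by (intro exI[of _ p] exI[of _ 1]) simp

lemma restricts_to_0: "restricts_to 0 0"
  using restricts_to_Fract[of 0] by (simp add: fract_collapse)

lemma restricts_to_1: "restricts_to 1 1"
  using restricts_to_Fract[of 1] by (simp add: fract_collapse)

lemma restricts_to_add:
  assumes "restricts_to f g" "restricts_to f' g'"
  shows "restricts_to (f + f') (g + g')"
proof -
  obtain p q p' q' where *: "diagonal q \<noteq> 0" "f = Fract p q" "diagonal p = g * diagonal q"
     "diagonal q' \<noteq> 0" "f' = Fract p' q'" "diagonal p' = g' * diagonal q'"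
    using assms unfolding restricts_to_def by blast
  then have "q \<noteq> 0" "q' \<noteq> 0" by auto
  with * show ?thesis unfolding restricts_to_def
    by (intro exI[of _ "p * q' + p' * q"] exI[of _ "q * q'"]) (simp add: algebra_simps)
qed

lemma restricts_to_minus:
  assumes "restricts_to f g"
  shows "restricts_to (- f) (- g)"
  using assms unfolding restricts_to_def by (metis diagonal_simps(4) minus_fract mult_minus_left)

lemma restricts_to_mult:
  assumes "restricts_to f g" "restricts_to f' g'"
  shows "restricts_to (f * f') (g * g')"
proof -
  obtain p q p' q' where *: "diagonal q \<noteq> 0" "f = Fract p q" "diagonal p = g * diagonal q"
     "diagonal q' \<noteq> 0" "f' = Fract p' q'" "diagonal p' = g' * diagonal q'"
    using assms unfolding restricts_to_def by blast
  then show ?thesis unfolding restricts_to_def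
    by (intro exI[of _ "p * p'"] exI[of _ "q * q'"]) (simp add: algebra_simps)
qed

text \<open>Dividing by \<open>f\<close> moves its numerator \<open>p\<close> into the denominator.
  This is harmless because \<open>diagonal p = g * diagonal q\<close> is nonzero. It is the tool for
  following the division in an exchange relation.\<close>

lemma restricts_to_cancel:
  assumes "restricts_to f g" "g \<noteq> 0" "restricts_to (f * f') (g * g')"
  shows "restricts_to f' g'"
proof -
  obtain p q p' q' where *: "diagonal q \<noteq> 0" "f = Fract p q" "diagonal p = g * diagonal q"
     "diagonal q' \<noteq> 0" "f * f' = Fract p' q'" "diagonal p' = g * g' * diagonal q'"
    using assms unfolding restricts_to_def by blast
  then have "q \<noteq> 0" "q' \<noteq> 0" "p \<noteq> 0" using assms(2) by auto
  have "f \<noteq> 0" using * \<open>q \<noteq> 0\<close> \<open>p \<noteq> 0\<close> by (simp add: Zero_fract_def eq_fract)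
  then have "f' = Fract p' q' / f" using * by (metis nonzero_mult_div_cancel_left)
  then have "f' = Fract (p' * q) (q' * p)" using * by simp
  then show ?thesis using * assms(2) unfolding restricts_to_def
    by (intro exI[of _ "p' * q"] exI[of _ "q' * p"]) (simp add: algebra_simps)
qed

section \<open>Mutations of the Markov seed\<close>

lemma prod_filter_3:
  "(\<Prod>j | P j. f j) =
     (if P 1 then f 1 else 1) * (if P 2 then f 2 else 1) * (if P (3::3) then f 3 else 1)"
proof -
  have "(\<Prod>j | P j. f j) = (\<Prod>j\<in>UNIV. if P j then f j else 1)"
    using prod.inter_filter[OF finite, where A = UNIV and P = P] by (simp only: UNIV_I simp_thms)
  then show ?thesis unfolding UNIV_3 by (simp add: mult.assoc)
qed

text \<open>Off-diagonal entries outside row and column \<open>i\<close> are 2 or -2 and change by 4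
  towards the opposite sign, so they are negated as well. Hence only two matrices ever
  occur.\<close>

lemma mutate_matrix_markov:
  assumes "C = markov_matrix \<or> C = - markov_matrix"
  shows "mutate_matrix C i = - C"
  using assms exhaust_3[of i]
  by (auto simp: mutate_matrix_def markov_matrix_def vec_eq_iff forall_3)

text \<open>Column \<open>i\<close> of \<open>C\<close> holds one entry 2 and one entry -2, so each
  monomial of the exchange polynomial is the square of one remaining variable. Negating
  \<open>C\<close> only swaps the two monomials.\<close>

lemma mutate_cluster_markov:
  fixes y :: "'f::field ^ 3"
  assumes "C = markov_matrix \<or> C = - markov_matrix"
  shows "mutate_cluster y C 1 = vector [((y $ 2)\<^sup>2 + (y $ 3)\<^sup>2) / y $ 1, y $ 2, y $ 3]"
    and "mutate_cluster y C 2 = vector [y $ 1, ((y $ 1)\<^sup>2 + (y $ 3)\<^sup>2) / y $ 2, y $ 3]"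
    and "mutate_cluster y C 3 = vector [y $ 1, y $ 2, ((y $ 1)\<^sup>2 + (y $ 2)\<^sup>2) / y $ 3]"
  using assms
  by (auto simp: mutate_cluster_def exchange_polynomial_def prod_filter_3 markov_matrix_def
      vec_eq_iff forall_3 add.commute)

section \<open>Closure properties and induction for cluster algebras\<close>

lemma cluster_algebra_closed:
  fixes x :: "'f::field ^ 'n::finite" and B :: "int ^ 'n ^ 'n"
  defines "A \<equiv> cluster_algebra x B"
  shows "1 \<in> A" "f \<in> A \<Longrightarrow> - f \<in> A" "f \<in> A \<Longrightarrow> g \<in> A \<Longrightarrow> f + g \<in> A"
    "f \<in> A \<Longrightarrow> g \<in> A \<Longrightarrow> f * g \<in> A"
    "mutation_reachable x B y C \<Longrightarrow> y $ i \<in> A"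
proof -
  note intros = generate_ring.intros[where R = "ring_of_type_algebra :: 'f ring"
      and H = "cluster_variables x B", folded cluster_algebra_def A_def, simplified]
  show "1 \<in> A" by (rule intros(1))
  show "f \<in> A \<Longrightarrow> - f \<in> A" by (rule intros(3))
  show "f \<in> A \<Longrightarrow> g \<in> A \<Longrightarrow> f + g \<in> A" by (rule intros(4))
  show "f \<in> A \<Longrightarrow> g \<in> A \<Longrightarrow> f * g \<in> A" by (rule intros(5))
  show "mutation_reachable x B y C \<Longrightarrow> y $ i \<in> A"
    by (rule intros(2)) (unfold cluster_variables_def, blast)
qed

text \<open>Presents generators as coordinates of reachable clusters and keeps the membership
  hypotheses, which the product step of the constant term argument uses.\<close>

lemma cluster_algebra_induct [consumes 1, case_names one var minus add mult]:
  assumes "f \<in> cluster_algebra x B"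
    and "P 1"
    and "\<And>y C i. mutation_reachable x B y C \<Longrightarrow> P (y $ i)"
    and "\<And>f. f \<in> cluster_algebra x B \<Longrightarrow> P f \<Longrightarrow> P (- f)"
    and "\<And>f g. f \<in> cluster_algebra x B \<Longrightarrow> P f \<Longrightarrow> g \<in> cluster_algebra x B \<Longrightarrow> P g \<Longrightarrow> P (f + g)"
    and "\<And>f g. f \<in> cluster_algebra x B \<Longrightarrow> P f \<Longrightarrow> g \<in> cluster_algebra x B \<Longrightarrow> P g \<Longrightarrow> P (f * g)"
  shows "P f"
  using assms(1) unfolding cluster_algebra_def
proof (induction rule: generate_ring.induct)
  case (incl h)
  then show ?case using assms(3) by (auto simp: cluster_variables_def)
qed (use assms in \<open>simp_all add: cluster_algebra_def\<close>)

abbreviation markov_algebra :: "ratfun3 set" where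
  "markov_algebra \<equiv> cluster_algebra markov_cluster markov_matrix"

abbreviation markov_reachable :: "ratfun3 ^ 3 \<Rightarrow> int ^ 3 ^ 3 \<Rightarrow> bool" where
  "markov_reachable \<equiv> mutation_reachable markov_cluster markov_matrix"

section \<open>The mutation invariant and Markov triples\<close>

definition markov_element :: "'f::field ^ 3 \<Rightarrow> 'f" where
  "markov_element y = ((y $ 1)\<^sup>2 + (y $ 2)\<^sup>2 + (y $ 3)\<^sup>2) / (y $ 1 * y $ 2 * y $ 3)"

text \<open>If \<open>d\<close> replaces \<open>a\<close>, then \<open>a * d = b^2 + c^2\<close>,
  and both values equal \<open>(a + d) / (b * c)\<close>, which is symmetric in \<open>a\<close> and
  \<open>d\<close>.\<close>

lemma markov_element_mutate:
  fixes y :: "'f::field ^ 3"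
  assumes "C = markov_matrix \<or> C = - markov_matrix"
    and "\<And>j. y $ j \<noteq> 0" "mutate_cluster y C i $ i \<noteq> 0"
  shows "markov_element (mutate_cluster y C i) = markov_element y"
proof -
  have *: "(((b\<^sup>2 + c\<^sup>2) / a)\<^sup>2 + (b\<^sup>2 + c\<^sup>2)) / ((b\<^sup>2 + c\<^sup>2) / a * (b * c)) =
      (a\<^sup>2 + (b\<^sup>2 + c\<^sup>2)) / (a * (b * c))" if nz: "(b\<^sup>2 + c\<^sup>2) / a \<noteq> 0" "a \<noteq> 0" for a b c :: 'f
  proof -
    define d where "d = (b\<^sup>2 + c\<^sup>2) / a"
    have d: "b\<^sup>2 + c\<^sup>2 = a * d" "d \<noteq> 0" using nz by (simp_all add: d_def)
    have "(d\<^sup>2 + a * d) / (d * (b * c)) = (d * (a + d)) / (d * (b * c))"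
      by (simp add: power2_eq_square algebra_simps)
    also have "\<dots> = (a * (a + d)) / (a * (b * c))"
      using d(2) nz(2) by simp
    also have "\<dots> = (a\<^sup>2 + a * d) / (a * (b * c))"
      by (simp add: power2_eq_square algebra_simps)
    \<comment> \<open>Rewriting \<open>b^2 + c^2\<close> as \<open>a * d\<close> also turns
      \<open>(b^2 + c^2) / a\<close> into \<open>d\<close>.\<close>
    finally show ?thesis unfolding d(1) nonzero_mult_div_cancel_left[OF nz(2)] .
  qed
  note mut = mutate_cluster_markov[OF assms(1), of y]
  consider "i = 1" | "i = 2" | "i = 3" using exhaust_3 by blast
  then show ?thesis
  proof cases
    case 1
    then show ?thesis
      using *[of "y $ 2" "y $ 3" "y $ 1"] assms(2)[of 1] assms(3)
      unfolding markov_element_def by (simp only: not_False_eq_True mut vector_3 add.assoc mult.assoc)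
  next
    case 2
    then show ?thesis
      using *[of "y $ 1" "y $ 3" "y $ 2"] assms(2)[of 2] assms(3)
      unfolding markov_element_def by (simp only: not_False_eq_True mut vector_3 add.left_commute mult.left_commute
          add.assoc mult.assoc)
  next
    case 3
    then show ?thesis
      using *[of "y $ 1" "y $ 2" "y $ 3"] assms(2)[of 3] assms(3)
      unfolding markov_element_def by (simp only: not_False_eq_True mut vector_3 ac_simps)
  qed
qed

text \<open>Vieta jumping: \<alpha> and \<delta> are the two roots of
  \<open>X^2 - 3 * \<beta> * \<gamma> * X + (\<beta>^2 + \<gamma>^2)\<close>, so exchanging one for
  the other preserves the Markov equation.\<close>

lemma restricts_to_markov_exchange:
  fixes \<alpha> \<beta> \<gamma> :: rat
  assumes "restricts_to a [:0, \<alpha>:]" "restricts_to b [:0, \<beta>:]" "restricts_to c [:0, \<gamma>:]"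
    and "\<alpha> \<noteq> 0" "\<beta> \<noteq> 0" and markov: "\<alpha>\<^sup>2 + \<beta>\<^sup>2 + \<gamma>\<^sup>2 = 3 * \<alpha> * \<beta> * \<gamma>"
  defines "\<delta> \<equiv> (\<beta>\<^sup>2 + \<gamma>\<^sup>2) / \<alpha>"
  shows "restricts_to ((b\<^sup>2 + c\<^sup>2) / a) [:0, \<delta>:]"
    and "\<delta> \<noteq> 0"
    and "\<delta>\<^sup>2 + \<beta>\<^sup>2 + \<gamma>\<^sup>2 = 3 * \<delta> * \<beta> * \<gamma>"
proof -
  have "a \<noteq> 0"
    using restricts_to_unique[OF assms(1)] restricts_to_0 \<open>\<alpha> \<noteq> 0\<close> by force
  have \<delta>: "\<alpha> * \<delta> = \<beta>\<^sup>2 + \<gamma>\<^sup>2" using \<open>\<alpha> \<noteq> 0\<close> by (simp add: \<delta>_def)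
  have "restricts_to (a * ((b\<^sup>2 + c\<^sup>2) / a)) ([:0, \<alpha>:] * [:0, \<delta>:])"
    using restricts_to_add[OF restricts_to_mult[OF assms(2,2)] restricts_to_mult[OF assms(3,3)]]
      \<open>a \<noteq> 0\<close> \<delta> by (simp add: power2_eq_square mult.commute[of \<delta>])
  then show "restricts_to ((b\<^sup>2 + c\<^sup>2) / a) [:0, \<delta>:]"
    by (rule restricts_to_cancel[OF assms(1), rotated]) (simp add: \<open>\<alpha> \<noteq> 0\<close>)
  \<comment> \<open>Over the rationals a sum of squares with a nonzero term is positive, so no
    mutation leads to a zero coefficient.\<close>
  have "\<beta>\<^sup>2 + \<gamma>\<^sup>2 > 0" using \<open>\<beta> \<noteq> 0\<close> by (simp add: add_pos_nonneg)
  then show "\<delta> \<noteq> 0" using \<delta> by auto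
  have "\<alpha> * \<delta> = \<alpha> * (3 * \<beta> * \<gamma> - \<alpha>)" 
    unfolding \<delta> using markov by (simp add: algebra_simps power2_eq_square)
  then have "\<alpha> + \<delta> = 3 * \<beta> * \<gamma>" using \<open>\<alpha> \<noteq> 0\<close> by simp
  then have "\<delta> * (\<alpha> + \<delta>) = \<delta> * (3 * \<beta> * \<gamma>)" by simp
  then show "\<delta>\<^sup>2 + \<beta>\<^sup>2 + \<gamma>\<^sup>2 = 3 * \<delta> * \<beta> * \<gamma>"
    using \<delta> by (simp add: algebra_simps power2_eq_square)
qed

lemma markov_reachable_matrix:
  assumes "markov_reachable y C"
  shows "C = markov_matrix \<or> C = - markov_matrix"
  using assms
proof induction
  case (mutate y C i)
  then show ?case by (metis mutate_matrix_markov minus_minus)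
qed simp

text \<open>On the diagonal the cluster becomes \<open>m * t\<close>. The Markov equation for
  \<open>m\<close> says that the invariant becomes \<open>3 / t\<close> there.\<close>

definition markov_triple :: "ratfun3 ^ 3 \<Rightarrow> rat ^ 3 \<Rightarrow> bool" where
  "markov_triple y m \<longleftrightarrow> (\<forall>i. m $ i \<noteq> 0 \<and> restricts_to (y $ i) [:0, m $ i:]) \<and>
     (m $ 1)\<^sup>2 + (m $ 2)\<^sup>2 + (m $ 3)\<^sup>2 = 3 * m $ 1 * m $ 2 * m $ 3"

lemma markov_triple_nonzero:
  assumes "markov_triple y m"
  shows "y $ i \<noteq> 0"
proof
  assume "y $ i = 0"
  then have "restricts_to 0 [:0, m $ i:]" "m $ i \<noteq> 0"
    using assms unfolding markov_triple_def by metis+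
  then show False using restricts_to_unique[OF restricts_to_0] by force
qed

lemma markov_triple_initial: "markov_triple markov_cluster (vector [1, 1, 1])"
  using restricts_to_Fract[of "[:[:[:0, 1::rat:]:]:]"] restricts_to_Fract[of "[:[:0, 1::rat poly:]:]"]
    restricts_to_Fract[of "[:0, 1::rat poly poly:]"]
  by (simp add: markov_triple_def markov_cluster_def forall_3 diagonal_def)

lemma markov_reachable_triple:
  assumes "markov_reachable y C"
  shows "\<exists>m. markov_triple y m"
  using assms
proof induction
  case initial
  then show ?case using markov_triple_initial by blast
next
  case (mutate y C i)
  then obtain m where m: "markov_triple y m" by blast
  then have nz: "m $ 1 \<noteq> 0" "m $ 2 \<noteq> 0" "m $ 3 \<noteq> 0"
    and r: "restricts_to (y $ 1) [:0, m $ 1:]" "restricts_to (y $ 2) [:0, m $ 2:]"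
      "restricts_to (y $ 3) [:0, m $ 3:]"
    and eq: "(m $ 1)\<^sup>2 + (m $ 2)\<^sup>2 + (m $ 3)\<^sup>2 = 3 * m $ 1 * m $ 2 * m $ 3"
    unfolding markov_triple_def by blast+
  \<comment> \<open>The exchange lemma replaces its first argument, so the Markov equation is
    permuted to bring \<open>m $ 2\<close> or \<open>m $ 3\<close> to the front.\<close>
  have eqs: "(m $ 2)\<^sup>2 + (m $ 1)\<^sup>2 + (m $ 3)\<^sup>2 = 3 * m $ 2 * m $ 1 * m $ 3"
    "(m $ 3)\<^sup>2 + (m $ 1)\<^sup>2 + (m $ 2)\<^sup>2 = 3 * m $ 3 * m $ 1 * m $ 2"
    using eq by (simp_all add: algebra_simps)
  note exchange = restricts_to_markov_exchange[OF r(1,2,3) nz(1,2) eq]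
    restricts_to_markov_exchange[OF r(2,1,3) nz(2,1) eqs(1)]
    restricts_to_markov_exchange[OF r(3,1,2) nz(3,1) eqs(2)]
  note mut = mutate_cluster_markov[OF markov_reachable_matrix[OF mutate.hyps]]
  consider "i = 1" | "i = 2" | "i = 3" using exhaust_3 by blast
  then show ?case
  proof cases
    case 1
    have "markov_triple (mutate_cluster y C i)
        (vector [((m $ 2)\<^sup>2 + (m $ 3)\<^sup>2) / m $ 1, m $ 2, m $ 3])"
      unfolding 1 mut markov_triple_def forall_3 vector_3 using exchange(1-3) nz r by blast
    then show ?thesis by blast
  next
    case 2
    have "markov_triple (mutate_cluster y C i)
        (vector [m $ 1, ((m $ 1)\<^sup>2 + (m $ 3)\<^sup>2) / m $ 2, m $ 3])"
      unfolding 2 mut markov_triple_def forall_3 vector_3 using exchange(4-6) nz r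
      by (simp only: ac_simps simp_thms)
    then show ?thesis by blast
  next
    case 3
    have "markov_triple (mutate_cluster y C i)
        (vector [m $ 1, m $ 2, ((m $ 1)\<^sup>2 + (m $ 2)\<^sup>2) / m $ 3])"
      unfolding 3 mut markov_triple_def forall_3 vector_3 using exchange(7-9) nz r
      by (simp only: ac_simps simp_thms)
    then show ?thesis by blast
  qed
qed

lemma markov_reachable_nonzero: "markov_reachable y C \<Longrightarrow> y $ i \<noteq> 0"
  using markov_reachable_triple markov_triple_nonzero by blast

lemma markov_reachable_element:
  assumes "markov_reachable y C"
  shows "markov_element y = markov_element markov_cluster"
  using assms
proof induction
  case (mutate y C i)
  then show ?case
    using markov_element_mutate markov_reachable_matrix markov_reachable_nonzero
      mutation_reachable.mutate[OF mutate.hyps] by metis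
qed simp

section \<open>The invariant lies in the quotient field but not in the algebra\<close>

lemma markov_algebra_restricts:
  assumes "f \<in> markov_algebra"
  shows "\<exists>g. restricts_to f g"
  using assms
proof (induction rule: cluster_algebra_induct)
  case (var y C i)
  then obtain m where "markov_triple y m" using markov_reachable_triple by blast
  then show ?case unfolding markov_triple_def by blast
qed (use restricts_to_1 restricts_to_minus restricts_to_add restricts_to_mult in meson)+

text \<open>A restriction \<open>g\<close> of the invariant would satisfy
  \<open>t^3 * g = 3 * t^2\<close>, hence \<open>t * g = 3\<close>, which fails at
  \<open>t = 0\<close>.\<close>

lemma markov_element_notin: "markov_element markov_cluster \<notin> markov_algebra"
proof
  let ?x = "\<lambda>i. markov_cluster $ i"
  have x: "restricts_to (?x i) [:0, 1:]" for i
    using markov_triple_initial exhaust_3[of i] by (auto simp: markov_triple_def forall_3)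
  assume "markov_element markov_cluster \<in> markov_algebra"
  then obtain g where g: "restricts_to (markov_element markov_cluster) g"
    using markov_algebra_restricts by blast
  have "?x i \<noteq> 0" for i
    using markov_triple_nonzero[OF markov_triple_initial] .
  then have "?x 1 * ?x 2 * ?x 3 * markov_element markov_cluster
      = ?x 1 * ?x 1 + ?x 2 * ?x 2 + ?x 3 * ?x 3"
    by (simp add: markov_element_def power2_eq_square)
  moreover have "restricts_to \<dots> ([:0, 1:] * [:0, 1:] + [:0, 1:] * [:0, 1:] + [:0, 1:] * [:0, 1:])"
    by (intro restricts_to_add restricts_to_mult x)
  moreover have "restricts_to (?x 1 * ?x 2 * ?x 3 * markov_element markov_cluster)
      ([:0, 1:] * [:0, 1:] * [:0, 1:] * g)"
    by (intro restricts_to_mult x g)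
  ultimately have "[:0, 1:] * [:0, 1:] * [:0, 1:] * g
      = ([:0, 1:] * [:0, 1:] + [:0, 1:] * [:0, 1:] + [:0, 1:] * [:0, 1:] :: rat poly)"
    using restricts_to_unique by metis
  then have "[:0, 1:] * [:0, 1:] * ([:0, 1:] * g) = [:0, 1:] * [:0, 1:] * [:3:: rat:]"
    by simp
  then have "[:0, 1:] * g = [:3::rat:]"
    by (metis mult_left_cancel no_zero_divisors one_neq_zero pCons_eq_0_iff)
  then have "poly ([:0, 1:] * g) 0 = 3" by simp
  then show False by simp
qed

lemma markov_cluster_in_algebra: "markov_cluster $ i \<in> markov_algebra"
  by (rule cluster_algebra_closed(5)[OF mutation_reachable.initial])

lemma markov_element_in_quotient_field:
  "markov_element markov_cluster \<in> quotient_field ring_of_type_algebra markov_algebra"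
  unfolding quotient_field_def markov_element_def power2_eq_square
  by (intro divide_in_localization_at cluster_algebra_closed(3,4) markov_cluster_in_algebra)
    (simp_all add: markov_triple_nonzero[OF markov_triple_initial])

section \<open>Height-one primes of the Markov cluster algebra\<close>

lemma cluster_variable_in_prime:
  assumes prime: "primeideal P (ring_of_type_algebra\<lparr>carrier := markov_algebra\<rparr>)"
    and notin: "markov_element markov_cluster \<notin> localization_at ring_of_type_algebra markov_algebra P"
    and y: "markov_reachable y C"
  shows "y $ i \<in> P"
proof -
  note P = primeideal_type_algebraD[OF cluster_algebra_subdomain(2) prime]
  note A = cluster_algebra_closed[where x = markov_cluster and B = markov_matrix]
  have yA: "y $ i \<in> markov_algebra" for i by (rule A(5)[OF y])
  have y'A: "mutate_cluster y C i $ i \<in> markov_algebra" for i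
    by (rule A(5)[OF mutation_reachable.mutate[OF y]])
  note mut = mutate_cluster_markov[OF markov_reachable_matrix[OF y], of y]
  note nz = markov_reachable_nonzero[OF y]
  \<comment> \<open>Here \<open>a\<close> is the variable to be exchanged for \<open>d\<close>. The
    invariant is \<open>(a + d) / (b * c)\<close>, so \<open>b * c\<close> outside \<open>P\<close>
    would put it into the localization. The second part comes from
    \<open>b^2 + c^2 = a * d\<close>.\<close>
  have exchange: "b * c \<in> P \<and> (a \<in> P \<longrightarrow> (b \<in> P \<longleftrightarrow> c \<in> P))"
    if abc: "a \<in> markov_algebra" "b \<in> markov_algebra" "c \<in> markov_algebra"
      and a': "(b\<^sup>2 + c\<^sup>2) / a \<in> markov_algebra" and nz: "a \<noteq> 0" "b \<noteq> 0" "c \<noteq> 0"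
      and M: "markov_element markov_cluster = (a\<^sup>2 + b\<^sup>2 + c\<^sup>2) / (a * b * c)" for a b c
  proof
    define d where "d = (b\<^sup>2 + c\<^sup>2) / a"
    have d: "b\<^sup>2 + c\<^sup>2 = a * d" "d \<in> markov_algebra" using nz a' by (simp_all add: d_def)
    have "markov_element markov_cluster = (a * (a + d)) / (a * (b * c))"
      unfolding M add.assoc d(1) by (simp add: power2_eq_square distrib_left mult.assoc)
    also have "\<dots> = (a + d) / (b * c)" using nz by simp
    finally have "(a + d) / (b * c) \<notin> localization_at ring_of_type_algebra markov_algebra P"
      using notin by simp
    then show "b * c \<in> P"
      using divide_in_localization_at[OF A(3)[OF abc(1) d(2)] A(4)[OF abc(2,3)]] nz
      by (metis no_zero_divisors)
    show "a \<in> P \<longrightarrow> (b \<in> P \<longleftrightarrow> c \<in> P)"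
    proof
      assume "a \<in> P"
      then have "d * a \<in> P" by (rule P(4)[OF d(2)])
      have bc: "c * c = d * a + (- b) * b" "b * b = d * a + (- c) * c"
        unfolding mult.commute[of d] d(1)[symmetric] by (simp_all add: power2_eq_square)
      show "b \<in> P \<longleftrightarrow> c \<in> P"
      proof
        assume "b \<in> P"
        then have "c * c \<in> P"
          unfolding bc(1) by (rule P(3)[OF \<open>d * a \<in> P\<close> P(4)[OF A(2)[OF abc(2)]]])
        then show "c \<in> P" using P(5)[OF abc(3,3)] by blast
      next
        assume "c \<in> P"
        then have "b * b \<in> P"
          unfolding bc(2) by (rule P(3)[OF \<open>d * a \<in> P\<close> P(4)[OF A(2)[OF abc(3)]]])
        then show "b \<in> P" using P(5)[OF abc(2,2)] by blast
      qed
    qed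
  qed
  have M: "markov_element markov_cluster =
      ((y $ 1)\<^sup>2 + (y $ 2)\<^sup>2 + (y $ 3)\<^sup>2) / (y $ 1 * y $ 2 * y $ 3)"
    using markov_reachable_element[OF y] by (simp add: markov_element_def)
  have M': "markov_element markov_cluster =
      ((y $ 2)\<^sup>2 + (y $ 1)\<^sup>2 + (y $ 3)\<^sup>2) / (y $ 2 * y $ 1 * y $ 3)"
    "markov_element markov_cluster =
      ((y $ 3)\<^sup>2 + (y $ 1)\<^sup>2 + (y $ 2)\<^sup>2) / (y $ 3 * y $ 1 * y $ 2)"
    unfolding M by (simp_all only: ac_simps)
  note e = exchange[OF yA[of 1] yA[of 2] yA[of 3] y'A[of 1, unfolded mut vector_3] nz nz nz M]
    exchange[OF yA[of 2] yA[of 1] yA[of 3] y'A[of 2, unfolded mut vector_3] nz nz nz M'(1)]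
    exchange[OF yA[of 3] yA[of 1] yA[of 2] y'A[of 3, unfolded mut vector_3] nz nz nz M'(2)]
  \<comment> \<open>Every product of two cluster variables lies in \<open>P\<close>, so at least two
    of the three variables do. The equivalence in \<open>exchange\<close> then forces the
    third.\<close>
  have "y $ 2 \<in> P \<or> y $ 3 \<in> P" "y $ 1 \<in> P \<or> y $ 3 \<in> P" "y $ 1 \<in> P \<or> y $ 2 \<in> P"
    using e by (meson P(5) yA)+
  then have "y $ 1 \<in> P \<and> y $ 2 \<in> P \<and> y $ 3 \<in> P" using e by argo
  then show ?thesis using exhaust_3[of i] by auto
qed

text \<open>The same integer \<open>c\<close> serves as residue modulo \<open>P\<close> and as value
  of the restriction at \<open>t = 0\<close>. Both are 0 on cluster variables and respect the ring
  operations.\<close>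

lemma markov_algebra_constant_term:
  assumes prime: "primeideal P (ring_of_type_algebra\<lparr>carrier := markov_algebra\<rparr>)"
    and var: "cluster_variables markov_cluster markov_matrix \<subseteq> P"
    and "f \<in> markov_algebra"
  shows "\<exists>c::int. \<exists>p\<in>P. \<exists>g. f = of_int c + p \<and> restricts_to f g \<and> poly g 0 = of_int c"
  using assms(3)
proof (induction rule: cluster_algebra_induct)
  note P = primeideal_type_algebraD[OF cluster_algebra_subdomain(2) prime]
  note A = cluster_algebra_closed[where x = markov_cluster and B = markov_matrix]
  {
    case one
    then show ?case using P(2) restricts_to_1
      by (intro exI[of _ 1] bexI[of _ 0] exI[of _ 1]) simp_all
  next
    case (var y C i)
    then obtain m where "markov_triple y m" using markov_reachable_triple by blast
    then have "restricts_to (y $ i) [:0, m $ i:]" unfolding markov_triple_def by blast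
    moreover have "y $ i \<in> P" using assms(2) var by (auto simp: cluster_variables_def)
    ultimately show ?case
      by (intro exI[of _ 0] bexI[of _ "y $ i"] exI[of _ "[:0, m $ i:]"]) simp_all
  next
    case (minus f)
    then obtain c p g where *: "f = of_int c + p" "p \<in> P" "restricts_to f g" "poly g 0 = of_int c"
      by blast
    have "- f = of_int (- c) + - p" using *(1) by simp
    moreover have "- p \<in> P" using P(4)[OF A(2)[OF A(1)] *(2)] by simp
    moreover have "poly (- g) 0 = of_int (- c)" using *(4) by simp
    ultimately show ?case using restricts_to_minus[OF *(3)] by blast
  next
    case (add f f')
    then obtain c p g c' p' g' where *:
      "f = of_int c + p" "p \<in> P" "restricts_to f g" "poly g 0 = of_int c"
      "f' = of_int c' + p'" "p' \<in> P" "restricts_to f' g'" "poly g' 0 = of_int c'"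
      by blast
    have "f + f' = of_int (c + c') + (p + p')" using *(1,5) by simp
    moreover have "p + p' \<in> P" using *(2,6) by (rule P(3))
    moreover have "poly (g + g') 0 = of_int (c + c')" using *(4,8) by simp
    ultimately show ?case using restricts_to_add[OF *(3,7)] by blast
  next
    case (mult f f')
    then obtain c p g c' p' g' where *:
      "f = of_int c + p" "p \<in> P" "restricts_to f g" "poly g 0 = of_int c"
      "f' = of_int c' + p'" "p' \<in> P" "restricts_to f' g'" "poly g' 0 = of_int c'"
      by blast
    \<comment> \<open>The remainder is \<open>c * p' + f' * p\<close>. Writing \<open>c\<close> as
      \<open>f + - p\<close> shows directly that this factor lies in the algebra.\<close>
    have "f * f' = of_int (c * c') + ((f + - p) * p' + f' * p)"
      unfolding *(1,5) by (simp add: algebra_simps)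
    moreover have "(f + - p) * p' + f' * p \<in> P"
      by (intro P(3,4) A(2,3) mult.hyps *(2,6) P(1)[OF *(2)])
    moreover have "poly (g * g') 0 = of_int (c * c')" using *(4,8) by simp
    ultimately show ?case using restricts_to_mult[OF *(3,7)] by blast
  }
qed

text \<open>Restriction acts as a ring homomorphism from the algebra to a polynomial ring over the
  rationals, which is a domain, so the kernel is prime.\<close>

lemma primeideal_diagonal_kernel:
  "primeideal {f \<in> markov_algebra. restricts_to f 0} (ring_of_type_algebra\<lparr>carrier := markov_algebra\<rparr>)"
  unfolding primeideal_type_algebra_iff[OF cluster_algebra_subdomain(2)]
proof (intro conjI ballI impI)
  let ?K = "{f \<in> markov_algebra. restricts_to f 0}"
  note A = cluster_algebra_closed[where x = markov_cluster and B = markov_matrix]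
  show "?K \<noteq> markov_algebra"
  proof
    assume "?K = markov_algebra"
    then have "restricts_to (1 :: ratfun3) 0" using A(1) by blast
    then show False using restricts_to_unique[OF restricts_to_1] by force
  qed
  have "1 + - 1 \<in> markov_algebra" by (intro A(1-3))
  then show "0 \<in> ?K" using restricts_to_0 by simp
  show "x + y \<in> ?K" if "x \<in> ?K" "y \<in> ?K" for x y
  proof -
    have "restricts_to (x + y) (0 + 0)" using that by (intro restricts_to_add) blast+
    then show ?thesis using A(3)[of x y] that by simp
  qed
  show "a * x \<in> ?K" if ax: "a \<in> markov_algebra" "x \<in> ?K" for a x
  proof -
    obtain g where "restricts_to a g" using markov_algebra_restricts[OF ax(1)] by blast
    then have "restricts_to (a * x) (g * 0)" using ax(2) by (intro restricts_to_mult) blast+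
    then show ?thesis using A(4)[of a x] ax by simp
  qed
  show "a \<in> ?K \<or> b \<in> ?K" if ab: "a \<in> markov_algebra" "b \<in> markov_algebra" "a * b \<in> ?K" for a b
  proof -
    obtain g h where gh: "restricts_to a g" "restricts_to b h"
      using ab(1,2) markov_algebra_restricts by meson
    have "restricts_to (a * b) 0" using ab(3) by blast
    then have "g * h = 0" by (rule restricts_to_unique[OF restricts_to_mult[OF gh]])
    then have "g = 0 \<or> h = 0" by simp
    then show ?thesis using gh ab(1,2) by blast
  qed
qed auto

lemma diagonal_kernel_nonzero: "\<exists>f\<in>markov_algebra. f \<noteq> 0 \<and> restricts_to f 0"
proof -
  \<comment> \<open>The difference of two initial variables vanishes on the diagonal.\<close>
  let ?f = "markov_cluster $ 1 + - markov_cluster $ 2"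
  have "?f \<in> markov_algebra"
    by (intro cluster_algebra_closed(2,3) markov_cluster_in_algebra)
  moreover have "markov_cluster $ 1 \<noteq> markov_cluster $ 2"
    by (simp add: markov_cluster_def eq_fract)
  then have "?f \<noteq> 0" by simp
  moreover have "restricts_to (markov_cluster $ 1) [:0, 1:]" "restricts_to (markov_cluster $ 2) [:0, 1:]"
    using markov_triple_initial unfolding markov_triple_def forall_3 vector_3 by blast+
  then have "restricts_to ?f ([:0, 1:] + - [:0, 1:])"
    by (intro restricts_to_add restricts_to_minus)
  then have "restricts_to ?f 0" by simp
  ultimately show ?thesis by blast
qed

theorem theorem6p5:
  shows "\<not> krull_domain ring_of_type_algebra (cluster_algebra markov_cluster markov_matrix)"
proof
  let ?R = "ring_of_type_algebra\<lparr>carrier := markov_algebra\<rparr>"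
  let ?K = "{f \<in> markov_algebra. restricts_to f 0}"
  assume "krull_domain ring_of_type_algebra markov_algebra"
  then have "markov_algebra = {x \<in> quotient_field ring_of_type_algebra markov_algebra.
      \<forall>P\<in>height_one_primes ?R. x \<in> localization_at ring_of_type_algebra markov_algebra P}"
    unfolding krull_domain_def Let_def by blast
  then obtain P where P: "P \<in> height_one_primes ?R"
    and M: "markov_element markov_cluster \<notin> localization_at ring_of_type_algebra markov_algebra P"
    using markov_element_notin markov_element_in_quotient_field by blast
  from P have prime: "primeideal P ?R" and height: "prime_height ?R P = 1"
    by (auto simp: height_one_primes_def)
  have var: "cluster_variables markov_cluster markov_matrix \<subseteq> P"
    using cluster_variable_in_prime[OF prime M] by (auto simp: cluster_variables_def)
  interpret K: field "ring_of_type_algebra :: ratfun3 ring" by (rule field_from_type_algebra)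
  have "primeideal {0} ?R"
    using domain.zeroprimeideal[OF K.subdomain_is_domain[OF cluster_algebra_subdomain(2)]] by simp
  moreover have "{0} \<subset> ?K"
    using diagonal_kernel_nonzero primeideal_diagonal_kernel
    unfolding primeideal_type_algebra_iff[OF cluster_algebra_subdomain(2)] by blast
  moreover have "?K \<subset> P"
  proof
    show "?K \<subseteq> P"
    proof
      fix f assume f: "f \<in> ?K"
      then obtain c :: int and p g where "f = of_int c + p" "p \<in> P" "restricts_to f g"
        "poly g 0 = of_int c"
        using markov_algebra_constant_term[OF prime var] by blast
      \<comment> \<open>The integer \<open>c\<close> is the constant term of the restriction, which
        is 0 on the kernel. Thus \<open>f = p\<close>.\<close>
      moreover from this f have "g = 0" using restricts_to_unique by blast
      ultimately show "f \<in> P" by simp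
    qed
    \<comment> \<open>The first initial variable lies in \<open>P\<close> but restricts to
      \<open>t\<close>, so the inclusion is strict.\<close>
    have "restricts_to (markov_cluster $ 1) [:0, 1:]"
      using markov_triple_initial by (auto simp: markov_triple_def forall_3)
    then have "markov_cluster $ 1 \<notin> ?K" using restricts_to_unique by force
    then show "?K \<noteq> P" using cluster_variable_in_prime[OF prime M mutation_reachable.initial] by blast
  qed
  ultimately have "prime_height ?R P \<noteq> 1"
    using prime_height_neq_one primeideal_diagonal_kernel prime by blast
  with height show False by contradiction
qed

end
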